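(* Let $\mu_1,\mu_2>0$, $q>0$, and let $a>1$, $b>1$, $c\ge0$ satisfy $(a-1)(b-1)\ge(c-1)^2$. Suppose that $Q_b<q$ and $Q_b\le\zeta_b$. Then an optimal distribution for the problem $$v_P(q;\theta)=\sup_{\mathbb P\in\mathcal F(\theta)}\mathbb E_{\mathbb P}[(X_1+X_2-q)_+]$$ is the one taking the value $(q-Q_b,0)$ with probability $p_1=\frac{b-1}{2b}+\frac{q(b-1)+\mu_1(c-b)}{2bQ_b}$, the value $(q+Q_b,0)$ with probability $p_2=\frac{b-1}{2b}-\frac{q(b-1)+\mu_1(c-b)}{2bQ_b}$, and the value $(c\mu_1,b\mu_2)$ with probability $p_3=\frac1b$. The optimal value is $$v_P(q;\theta)=\frac{b-1}{2b}\left((q+Q_b)-\frac{b-c}{b-1}\mu_1\right)+\mu_1+\mu_2-q .$$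
   Context: $(t)_+=\max\{t,0\}$. $\theta=(\mu_1,\mu_2,a\mu_1^2,b\mu_2^2,c\mu_1\mu_2)$, and $\mathcal F(\theta)$ is the set of all probability distributions $\mathbb P$ of a random vector $(X_1,X_2)$ supported on $\mathbb R_+^2=[0,\infty)^2$ such that $\mathbb E_{\mathbb P}[X_1]=\mu_1$, $\mathbb E_{\mathbb P}[X_2]=\mu_2$, $\mathbb E_{\mathbb P}[X_1^2]=a\mu_1^2$, $\mathbb E_{\mathbb P}[X_2^2]=b\mu_2^2$, $\mathbb E_{\mathbb P}[X_1X_2]=c\mu_1\mu_2$. "Optimal distribution" means a distribution belonging to $\mathcal F(\theta)$ at which the supremum is attained. Notation: $$Q_b=\sqrt{q^2-2q\tfrac{b-c}{b-1}\mu_1+\tfrac{ab-c^2}{b-1}\mu_1^2},\qquad \zeta_b=c\mu_1+b\mu_2-q.$$ *)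

theory Defs
  imports "HOL-Probability.Probability"
begin

type_synonym moments = "real \<times> real \<times> real \<times> real \<times> real"

definition theta :: "real \<Rightarrow> real \<Rightarrow> real \<Rightarrow> real \<Rightarrow> real \<Rightarrow> moments" where
  "theta \<mu>1 \<mu>2 a b c = (\<mu>1, \<mu>2, a * \<mu>1\<^sup>2, b * \<mu>2\<^sup>2, c * \<mu>1 * \<mu>2)"

definition has_mean :: "'a measure \<Rightarrow> ('a \<Rightarrow> real) \<Rightarrow> real \<Rightarrow> bool" where
  "has_mean P X m \<longleftrightarrow> integrable P X \<and> (\<integral>x. X x \<partial>P) = m"

(* Laws of a random vector: the components of moments are, in order,
   E[X1], E[X2], E[X1^2], E[X2^2], E[X1 X2].  *)
fun feasible :: "moments \<Rightarrow> (real \<times> real) measure set" where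
  "feasible (m1, m2, s1, s2, s12) =
     {P. prob_space P \<and> sets P = sets borel
       \<and> (AE x in P. 0 \<le> fst x \<and> 0 \<le> snd x)
       \<and> has_mean P (\<lambda>x. fst x) m1
       \<and> has_mean P (\<lambda>x. snd x) m2
       \<and> has_mean P (\<lambda>x. (fst x)\<^sup>2) s1
       \<and> has_mean P (\<lambda>x. (snd x)\<^sup>2) s2
       \<and> has_mean P (\<lambda>x. fst x * snd x) s12}"

definition expected_payoff :: "real \<Rightarrow> (real \<times> real) measure \<Rightarrow> real" where
  "expected_payoff q P = (\<integral>x. max (fst x + snd x - q) 0 \<partial>P)"

(* The payoff is integrable for every feasible law because the first moments
   exist. The supremum is taken in ereal so that it is a genuine least upper
   bound without a boundedness or nonemptiness side condition. *)
definition v_P :: "real \<Rightarrow> moments \<Rightarrow> ereal" where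
  "v_P q \<theta> = (SUP P\<in>feasible \<theta>. ereal (expected_payoff q P))"

definition optimal :: "real \<Rightarrow> moments \<Rightarrow> (real \<times> real) measure \<Rightarrow> bool" where
  "optimal q \<theta> P \<longleftrightarrow> P \<in> feasible \<theta> \<and> ereal (expected_payoff q P) = v_P q \<theta>"

(* measure_pmf carries the discrete sigma-algebra; this is the same law on the
   Borel sets. *)
definition borel_law :: "'a::topological_space pmf \<Rightarrow> 'a measure" where
  "borel_law p = distr (measure_pmf p) borel (\<lambda>x. x)"

definition Q_b :: "real \<Rightarrow> real \<Rightarrow> real \<Rightarrow> real \<Rightarrow> real \<Rightarrow> real" where
  "Q_b \<mu>1 a b c q =
     sqrt (q\<^sup>2 - 2 * q * ((b - c) / (b - 1)) * \<mu>1 + ((a * b - c\<^sup>2) / (b - 1)) * \<mu>1\<^sup>2)"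

definition zeta_b :: "real \<Rightarrow> real \<Rightarrow> real \<Rightarrow> real \<Rightarrow> real \<Rightarrow> real" where
  "zeta_b \<mu>1 \<mu>2 b c q = c * \<mu>1 + b * \<mu>2 - q"

(* Weights of (q - Q_b, 0) and (q + Q_b, 0). If Q_b = 0 the two atoms coincide,
   the numerator of the fraction is 0 as well, and x / 0 = 0 leaves the merged
   atom (q, 0) with its total weight (b - 1) / b. *)
definition p1 :: "real \<Rightarrow> real \<Rightarrow> real \<Rightarrow> real \<Rightarrow> real \<Rightarrow> real" where
  "p1 \<mu>1 a b c q =
     (b - 1) / (2 * b) + (q * (b - 1) + \<mu>1 * (c - b)) / (2 * b * Q_b \<mu>1 a b c q)"

definition p2 :: "real \<Rightarrow> real \<Rightarrow> real \<Rightarrow> real \<Rightarrow> real \<Rightarrow> real" where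
  "p2 \<mu>1 a b c q =
     (b - 1) / (2 * b) - (q * (b - 1) + \<mu>1 * (c - b)) / (2 * b * Q_b \<mu>1 a b c q)"

(* Value-probability pairs. pmf_of_list is only meaningful on lists satisfying
   pmf_of_list_wf (nonnegative weights of total 1); weights of repeated values
   are added. *)
definition three_points ::
    "real \<Rightarrow> real \<Rightarrow> real \<Rightarrow> real \<Rightarrow> real \<Rightarrow> real \<Rightarrow> ((real \<times> real) \<times> real) list" where
  "three_points \<mu>1 \<mu>2 a b c q =
     [((q - Q_b \<mu>1 a b c q, 0), p1 \<mu>1 a b c q),
      ((q + Q_b \<mu>1 a b c q, 0), p2 \<mu>1 a b c q),
      ((c * \<mu>1, b * \<mu>2), 1 / b)]"

end

theory Submission
  imports Defs
begin

text \<open>The upper bound comes from one linear form. Put \<open>s = (q + Q - c \<mu>1) / (b \<mu>2)\<close> with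
  \<open>Q = Q_b\<close>, and \<open>u = x1 - q + s x2\<close>. The condition \<open>Q \<le> \<zeta>\<close> says exactly that \<open>s \<le> 1\<close>, so that on
  the quadrant the payoff is at most \<open>(\<bar>u\<bar> + u) / 2 + (1 - s) x2\<close>. The second moment of \<open>u\<close> is
  \<open>Q\<^sup>2\<close> for every feasible law, hence \<open>E \<bar>u\<bar> \<le> Q\<close>. Both inequalities are equalities for the
  three-point law, because \<open>u\<close> takes the values \<open>-Q\<close>, \<open>Q\<close>, \<open>Q\<close> at its atoms.\<close>

text \<open>Values in \<open>xs\<close> may repeat, as the first two atoms of
  \<open>three_points\<close> do when \<open>Q_b\<close> is zero, so the sum over the support has to
  be regrouped entry by entry.\<close>

lemma expectation_pmf_of_list:
  fixes f :: "'a \<Rightarrow> real"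
  assumes "pmf_of_list_wf xs"
  shows "measure_pmf.expectation (pmf_of_list xs) f = (\<Sum>(x, w)\<leftarrow>xs. w * f x)"
proof -
  \<comment> \<open>\<open>A\<close> is kept separate from \<open>ys\<close>: the induction shrinks
    the list while the index set stays fixed.\<close>
  have sum: "(\<Sum>a\<in>A. f a * sum_list (map snd (filter (\<lambda>z. fst z = a) ys))) = (\<Sum>(x, w)\<leftarrow>ys. w * f x)"
    if "finite A" "set (map fst ys) \<subseteq> A" for A and ys :: "('a \<times> real) list"
    using that
  proof (induction ys)
    case Nil
    show ?case by simp
  next
    case (Cons z ys)
    obtain x w where z: "z = (x, w)" by (cases z)
    have "(\<Sum>a\<in>A. f a * sum_list (map snd (filter (\<lambda>y. fst y = a) (z # ys))))
        = (\<Sum>a\<in>A. (if x = a then w * f a else 0) + f a * sum_list (map snd (filter (\<lambda>y. fst y = a) ys)))"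
      by (intro sum.cong) (auto simp: z algebra_simps)
    also have "\<dots> = w * f x + (\<Sum>(x, w)\<leftarrow>ys. w * f x)"
      using Cons by (auto simp: z sum.distrib)
    finally show ?case by (simp add: z)
  qed
  have "measure_pmf.expectation (pmf_of_list xs) f = (\<Sum>a\<in>set (map fst xs). f a * pmf (pmf_of_list xs) a)"
    using set_pmf_of_list[OF assms] by (intro integral_measure_pmf_real) auto
  also have "\<dots> = (\<Sum>(x, w)\<leftarrow>xs. w * f x)"
    using sum[of "set (map fst xs)" xs] assms by (simp add: pmf_pmf_of_list)
  finally show ?thesis .
qed

lemma borel_law_integral:
  fixes f :: "'a::topological_space \<Rightarrow> real"
  assumes "f \<in> borel_measurable borel"
  shows "(\<integral>x. f x \<partial>borel_law p) = measure_pmf.expectation p f"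
  unfolding borel_law_def using assms by (subst integral_distr) auto

lemma borel_law_has_mean:
  fixes f :: "'a::topological_space \<Rightarrow> real"
  assumes "pmf_of_list_wf xs" and "f \<in> borel_measurable borel"
    and "(\<Sum>(x, w)\<leftarrow>xs. w * f x) = m"
  shows "has_mean (borel_law (pmf_of_list xs)) f m"
proof -
  have "finite (set_pmf (pmf_of_list xs))"
    using set_pmf_of_list[OF assms(1)] finite_subset by blast
  hence "integrable (measure_pmf (pmf_of_list xs)) f"
    by (rule integrable_measure_pmf_finite)
  hence "integrable (borel_law (pmf_of_list xs)) f"
    unfolding borel_law_def using assms(2) by (subst integrable_distr_eq) auto
  thus ?thesis
    using assms by (simp add: has_mean_def borel_law_integral expectation_pmf_of_list)
qed

lemma borel_law_feasible:
  assumes wf: "pmf_of_list_wf xs"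
    and "\<And>x. x \<in> set xs \<Longrightarrow> 0 \<le> fst (fst x) \<and> 0 \<le> snd (fst x)"
    and "(\<Sum>(x, w)\<leftarrow>xs. w * fst x) = m1" and "(\<Sum>(x, w)\<leftarrow>xs. w * snd x) = m2"
    and "(\<Sum>(x, w)\<leftarrow>xs. w * (fst x)\<^sup>2) = s1" and "(\<Sum>(x, w)\<leftarrow>xs. w * (snd x)\<^sup>2) = s2"
    and "(\<Sum>(x, w)\<leftarrow>xs. w * (fst x * snd x)) = s12"
  shows "borel_law (pmf_of_list xs) \<in> feasible (m1, m2, s1, s2, s12)"
proof -
  have "prob_space (borel_law (pmf_of_list xs))"
    unfolding borel_law_def by (intro measure_pmf.prob_space_distr) auto
  moreover have "AE x in borel_law (pmf_of_list xs). 0 \<le> fst x \<and> 0 \<le> snd x"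
  proof -
    \<comment> \<open>Closedness makes the quadrant Borel, as needed to pull the almost-everywhere
      statement back through \<open>distr\<close>.\<close>
    have "closed {x :: real \<times> real. 0 \<le> fst x \<and> 0 \<le> snd x}"
      by (intro closed_Collect_conj closed_Collect_le continuous_intros)
    hence "{x \<in> space borel. 0 \<le> fst x \<and> 0 \<le> snd x} \<in> sets (borel :: (real \<times> real) measure)"
      by (simp add: borel_closed)
    thus ?thesis
      unfolding borel_law_def using set_pmf_of_list[OF wf] assms(2)
      by (subst AE_distr_iff) (auto simp: AE_measure_pmf_iff)
  qed
  moreover have "sets (borel_law (pmf_of_list xs)) = sets borel"
    by (simp add: borel_law_def)
  ultimately show ?thesis
    using assms(3-) by (auto intro!: borel_law_has_mean[OF wf] borel_measurable_continuous_onI continuous_intros)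
qed

text \<open>The variance of \<open>\<bar>X\<bar>\<close> is nonnegative, and its second moment is
  that of \<open>X\<close>.\<close>

lemma (in prob_space) expectation_abs_le_sqrt:
  fixes X :: "'a \<Rightarrow> real"
  assumes "integrable M X" and "integrable M (\<lambda>x. (X x)\<^sup>2)"
  shows "expectation (\<lambda>x. \<bar>X x\<bar>) \<le> sqrt (expectation (\<lambda>x. (X x)\<^sup>2))"
proof -
  have "0 \<le> variance (\<lambda>x. \<bar>X x\<bar>)"
    by (rule variance_positive)
  also have "\<dots> = expectation (\<lambda>x. (X x)\<^sup>2) - (expectation (\<lambda>x. \<bar>X x\<bar>))\<^sup>2"
    using assms by (subst variance_eq) auto
  finally show ?thesis
    by (intro real_le_rsqrt) simp
qed

text \<open>The moment condition makes the radicand nonnegative, so the root can be squared. The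
  second bound is what later makes both weights nonnegative.\<close>

lemma Q_b_power2:
  assumes "b > 1" and "(a - 1) * (b - 1) \<ge> (c - 1)\<^sup>2"
  shows Q_b_sq: "(b - 1) * (Q_b \<mu>1 a b c q)\<^sup>2 = (b - 1) * q\<^sup>2 - 2 * q * (b - c) * \<mu>1 + (a * b - c\<^sup>2) * \<mu>1\<^sup>2"
    and Q_b_abs_le: "\<bar>q * (b - 1) + \<mu>1 * (c - b)\<bar> \<le> (b - 1) * Q_b \<mu>1 a b c q"
proof -
  define D where "D = q\<^sup>2 - 2 * q * ((b - c) / (b - 1)) * \<mu>1 + ((a * b - c\<^sup>2) / (b - 1)) * \<mu>1\<^sup>2"
  have bD: "(b - 1) * D = (b - 1) * q\<^sup>2 - 2 * q * (b - c) * \<mu>1 + (a * b - c\<^sup>2) * \<mu>1\<^sup>2"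
  proof -
    have "(b - 1) * ((b - c) / (b - 1)) = b - c"
      and "(b - 1) * ((a * b - c\<^sup>2) / (b - 1)) = a * b - c\<^sup>2"
      using assms(1) by simp_all
    thus ?thesis unfolding D_def by algebra
  qed
  have "(b - 1)\<^sup>2 * D = (b - 1) * ((b - 1) * D)"
    by (simp add: power2_eq_square)
  \<comment> \<open>Completing the square in \<open>q\<close>; the remainder is a positive multiple
    of the slack in the covariance inequality.\<close>
  also have "\<dots> = (q * (b - 1) + \<mu>1 * (c - b))\<^sup>2 + b * \<mu>1\<^sup>2 * ((a - 1) * (b - 1) - (c - 1)\<^sup>2)"
    unfolding bD by algebra
  finally have square: "(q * (b - 1) + \<mu>1 * (c - b))\<^sup>2 \<le> (b - 1)\<^sup>2 * D"
    using assms by simp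
  have "0 \<le> (b - 1)\<^sup>2 * D"
    using square by (rule order_trans[OF zero_le_power2])
  hence D: "0 \<le> D"
    using assms(1) by (simp add: zero_le_mult_iff)
  have Q: "Q_b \<mu>1 a b c q = sqrt D"
    by (simp add: Q_b_def D_def)
  show "(b - 1) * (Q_b \<mu>1 a b c q)\<^sup>2 = (b - 1) * q\<^sup>2 - 2 * q * (b - c) * \<mu>1 + (a * b - c\<^sup>2) * \<mu>1\<^sup>2"
    using bD D by (simp add: Q)
  show "\<bar>q * (b - 1) + \<mu>1 * (c - b)\<bar> \<le> (b - 1) * Q_b \<mu>1 a b c q"
    using real_sqrt_le_mono[OF square] assms(1) by (simp add: Q real_sqrt_mult)
qed

text \<open>The linear-form bound with the slope \<open>s\<close> left free; the radicand is the
  second moment of \<open>u\<close>, expanded in the five given moments.\<close>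

lemma expected_payoff_le:
  assumes P: "P \<in> feasible (m1, m2, s1, s2, s12)" and s: "s \<le> 1"
  shows "expected_payoff q P
    \<le> (sqrt (s1 + q\<^sup>2 + s\<^sup>2 * s2 - 2 * q * m1 + 2 * s * s12 - 2 * q * s * m2) + m1 - q + s * m2) / 2
      + (1 - s) * m2"
proof -
  interpret prob_space P using P by simp
  have int [simp]: "integrable P fst" "integrable P snd" "integrable P (\<lambda>x. (fst x)\<^sup>2)"
      "integrable P (\<lambda>x. (snd x)\<^sup>2)" "integrable P (\<lambda>x. fst x * snd x)"
    and mean [simp]: "expectation fst = m1" "expectation snd = m2" "expectation (\<lambda>x. (fst x)\<^sup>2) = s1"
      "expectation (\<lambda>x. (snd x)\<^sup>2) = s2" "expectation (\<lambda>x. fst x * snd x) = s12"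
    using P by (auto simp: has_mean_def)
  define u where "u = (\<lambda>x::real \<times> real. fst x - q + s * snd x)"
  have u2: "(\<lambda>x. (u x)\<^sup>2) = (\<lambda>x. (fst x)\<^sup>2 + q\<^sup>2 + s\<^sup>2 * (snd x)\<^sup>2 - 2 * q * fst x
      + 2 * s * (fst x * snd x) - 2 * q * s * snd x)"
    by (auto simp: u_def power2_eq_square algebra_simps)
  have iu: "integrable P u" and Eu: "expectation u = m1 - q + s * m2"
    by (simp_all add: u_def prob_space)
  have iu2: "integrable P (\<lambda>x. (u x)\<^sup>2)"
    and Eu2: "expectation (\<lambda>x. (u x)\<^sup>2) = s1 + q\<^sup>2 + s\<^sup>2 * s2 - 2 * q * m1 + 2 * s * s12 - 2 * q * s * m2"
    by (simp_all add: u2 prob_space)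
  have "expected_payoff q P \<le> expectation (\<lambda>x. (\<bar>u x\<bar> + u x) / 2 + (1 - s) * snd x)"
    unfolding expected_payoff_def
  proof (rule integral_mono_AE)
    show "AE x in P. max (fst x + snd x - q) 0 \<le> (\<bar>u x\<bar> + u x) / 2 + (1 - s) * snd x"
    proof -
      have "AE x in P. 0 \<le> snd x"
        using P by auto
      thus ?thesis
      proof eventually_elim
        case (elim x)
        \<comment> \<open>The positive part of \<open>u + r\<close> is at most that of
          \<open>u\<close> plus \<open>r\<close> when \<open>r \<ge> 0\<close>; here
          \<open>r = (1 - s) * snd x\<close>.\<close>
        hence "0 \<le> (1 - s) * snd x"
          using s by simp
        moreover have "fst x + snd x - q = u x + (1 - s) * snd x"
          by (simp add: u_def algebra_simps)
        ultimately show ?case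
          by (simp add: max_def abs_if)
      qed
    qed
  qed (use iu in auto)
  also have "\<dots> = (expectation (\<lambda>x. \<bar>u x\<bar>) + expectation u) / 2 + (1 - s) * m2"
    using iu by simp
  also have "\<dots> \<le> (sqrt (expectation (\<lambda>x. (u x)\<^sup>2)) + expectation u) / 2 + (1 - s) * m2"
    using expectation_abs_le_sqrt[OF iu iu2] by simp
  finally show ?thesis
    by (simp add: Eu Eu2 add_diff_eq diff_add_eq add.assoc)
qed

theorem lemmaB2p2:
  fixes \<mu>1 \<mu>2 q a b c :: real
  assumes "\<mu>1 > 0" and "\<mu>2 > 0" and "q > 0"
    and "a > 1" and "b > 1" and "c \<ge> 0"
    and "(a - 1) * (b - 1) \<ge> (c - 1)\<^sup>2"
    and "Q_b \<mu>1 a b c q < q"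
    and "Q_b \<mu>1 a b c q \<le> zeta_b \<mu>1 \<mu>2 b c q"
  shows "pmf_of_list_wf (three_points \<mu>1 \<mu>2 a b c q)
    \<and> optimal q (theta \<mu>1 \<mu>2 a b c) (borel_law (pmf_of_list (three_points \<mu>1 \<mu>2 a b c q)))
    \<and> v_P q (theta \<mu>1 \<mu>2 a b c) =
        ereal ((b - 1) / (2 * b) * ((q + Q_b \<mu>1 a b c q) - (b - c) / (b - 1) * \<mu>1)
          + \<mu>1 + \<mu>2 - q)"
proof -
  define Q where "Q = Q_b \<mu>1 a b c q"
  define k where "k = q * (b - 1) + \<mu>1 * (c - b)"
  define V where "V = (b - 1) / (2 * b) * ((q + Q) - (b - c) / (b - 1) * \<mu>1) + \<mu>1 + \<mu>2 - q"
  have V: "V = ((b - 1) * (q + Q) - (b - c) * \<mu>1) / (2 * b) + \<mu>1 + \<mu>2 - q"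
    using assms(5) by (simp add: V_def right_diff_distrib[of "b - 1" "q + Q"])
  let ?w1 = "p1 \<mu>1 a b c q" and ?w2 = "p2 \<mu>1 a b c q"
  let ?xs = "three_points \<mu>1 \<mu>2 a b c q"
  let ?P = "borel_law (pmf_of_list ?xs)"
  have Q2: "(b - 1) * Q\<^sup>2 = (b - 1) * q\<^sup>2 - 2 * q * (b - c) * \<mu>1 + (a * b - c\<^sup>2) * \<mu>1\<^sup>2"
    unfolding Q_def by (rule Q_b_sq[OF assms(5,7)])
  have k_le: "\<bar>k\<bar> \<le> (b - 1) * Q"
    unfolding k_def Q_def by (rule Q_b_abs_le[OF assms(5,7)])
  hence Q0: "0 \<le> Q"
    using assms(5) abs_ge_zero order_trans zero_le_mult_iff by (metis diff_gt_0_iff_gt not_less)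
  have zeta: "Q \<le> c * \<mu>1 + b * \<mu>2 - q"
    using assms(9) by (simp add: Q_def zeta_b_def)
  have w: "?w1 = (b - 1) / (2 * b) + k / (2 * b * Q)" "?w2 = (b - 1) / (2 * b) - k / (2 * b * Q)"
    by (simp_all only: p1_def p2_def k_def Q_def)
  have w_sum: "?w1 + ?w2 = (b - 1) / b"
    using assms(5) by (simp add: w field_simps)
  \<comment> \<open>The factor \<open>Q\<close> keeps this valid at \<open>Q = 0\<close>, where
    \<open>k_le\<close> forces \<open>k = 0\<close>. The moments and the payoff below depend on the
    two weights only through \<open>w_sum\<close> and \<open>w_diff\<close>.\<close>
  have w_diff: "(?w2 - ?w1) * Q = - k / b"
  proof (cases "Q = 0")
    case True
    with k_le show ?thesis by simp
  next
    case False
    with assms(5) show ?thesis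
      by (simp add: w field_simps)
  qed
  \<comment> \<open>At \<open>Q = 0\<close> the quotient is zero by convention; otherwise this is
    \<open>k_le\<close> divided by \<open>2 * b * Q\<close>.\<close>
  have "\<bar>k / (2 * b * Q)\<bar> \<le> (b - 1) / (2 * b)"
  proof (cases "Q = 0")
    case True
    with assms(5) show ?thesis by simp
  next
    case False
    with Q0 k_le assms(5) show ?thesis
      by (simp add: abs_mult field_simps)
  qed
  hence w_nonneg: "0 \<le> ?w1" "0 \<le> ?w2"
    unfolding w by linarith+
  have xs: "?xs = [((q - Q, 0), ?w1), ((q + Q, 0), ?w2), ((c * \<mu>1, b * \<mu>2), 1 / b)]"
    by (simp add: three_points_def Q_def)
  have wf: "pmf_of_list_wf ?xs"
    using w_sum w_nonneg assms(5) unfolding pmf_of_list_wf_def xs by (auto simp: field_simps)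
  have m1: "?w1 * (q - Q) + ?w2 * (q + Q) + c * \<mu>1 / b = \<mu>1"
  proof -
    have "?w1 * (q - Q) + ?w2 * (q + Q) = (?w1 + ?w2) * q + (?w2 - ?w1) * Q"
      by algebra
    also have "\<dots> = \<mu>1 - c * \<mu>1 / b"
      unfolding w_sum w_diff using assms(5) by (simp add: k_def field_simps)
    finally show ?thesis by simp
  qed
  \<comment> \<open>Expanding around \<open>q\<close> leaves a term in \<open>Q\<^sup>2\<close>,
    which \<open>Q2\<close> turns into the prescribed second moment.\<close>
  have s1: "?w1 * (q - Q)\<^sup>2 + ?w2 * (q + Q)\<^sup>2 + (c * \<mu>1)\<^sup>2 / b = a * \<mu>1\<^sup>2"
  proof -
    have "?w1 * (q - Q)\<^sup>2 + ?w2 * (q + Q)\<^sup>2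
        = (?w1 + ?w2) * (q\<^sup>2 + Q\<^sup>2) + 2 * q * ((?w2 - ?w1) * Q)"
      by algebra
    also have "\<dots> = ((b - 1) * q\<^sup>2 + (b - 1) * Q\<^sup>2 - 2 * q * k) / b"
      unfolding w_sum w_diff using assms(5) by (simp add: field_simps)
    also have "\<dots> = a * \<mu>1\<^sup>2 - (c * \<mu>1)\<^sup>2 / b"
      unfolding Q2 k_def using assms(5) by (simp add: field_simps power2_eq_square)
    finally show ?thesis by simp
  qed
  have feas: "?P \<in> feasible (theta \<mu>1 \<mu>2 a b c)"
    unfolding theta_def
  proof (rule borel_law_feasible[OF wf])
    show "0 \<le> fst (fst x) \<and> 0 \<le> snd (fst x)" if "x \<in> set ?xs" for x
      \<comment> \<open>The assumption \<open>Q_b < q\<close> puts the atom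
        \<open>(q - Q, 0)\<close> into the quadrant.\<close>
      using that assms(1-6,8) Q0 by (auto simp: xs Q_def[symmetric])
  \<comment> \<open>The moments involving the second coordinate come from the third atom
    alone.\<close>
  qed (use m1 s1 assms(5) in \<open>simp_all add: xs power2_eq_square add.assoc\<close>)
  have payoff: "expected_payoff q ?P = V"
  proof -
    have "expected_payoff q ?P = (\<Sum>(x, w)\<leftarrow>?xs. w * max (fst x + snd x - q) 0)"
      unfolding expected_payoff_def
      by (subst borel_law_integral)
        (auto intro!: borel_measurable_continuous_onI continuous_intros expectation_pmf_of_list[OF wf])
    \<comment> \<open>The first atom pays nothing since \<open>Q \<ge> 0\<close>; the third pays its
      full excess over \<open>q\<close>, nonnegative by \<open>zeta\<close>.\<close>
    also have "\<dots> = ?w2 * Q + (c * \<mu>1 + b * \<mu>2 - q) / b"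
      using zeta Q0 by (simp add: xs)
    also have "?w2 * Q = ((?w1 + ?w2) * Q + (?w2 - ?w1) * Q) / 2"
      by (simp add: field_simps)
    also have "\<dots> + (c * \<mu>1 + b * \<mu>2 - q) / b = V"
      unfolding w_sum w_diff V k_def using assms(5) by (simp add: field_simps)
    finally show ?thesis .
  qed
  have bound: "expected_payoff q P \<le> V" if P: "P \<in> feasible (theta \<mu>1 \<mu>2 a b c)" for P
  proof -
    \<comment> \<open>\<open>t\<close> solves \<open>c * \<mu>1 - q + b * t = Q\<close>, so that
      \<open>u\<close> equals \<open>Q\<close> at the third atom; working with
      \<open>t = s * \<mu>2\<close> removes \<open>\<mu>2\<close> from the algebra.\<close>
    define t where "t = (q + Q - c * \<mu>1) / b"
    define s where "s = t / \<mu>2"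
    have bt: "b * t = q + Q - c * \<mu>1" and st: "s * \<mu>2 = t"
      using assms(2,5) by (simp_all add: t_def s_def)
    have "b * t \<le> b * \<mu>2"
      using zeta by (simp add: bt)
    hence s: "s \<le> 1"
      using assms(2,5) by (simp add: s_def)
    define M where "M = a * \<mu>1\<^sup>2 + q\<^sup>2 + s\<^sup>2 * (b * \<mu>2\<^sup>2) - 2 * q * \<mu>1 + 2 * s * (c * \<mu>1 * \<mu>2) - 2 * q * s * \<mu>2"
    \<comment> \<open>The factor \<open>b\<close> turns the quadratic term in \<open>s\<close> into
      \<open>(b * t)\<^sup>2\<close>. Substituting \<open>bt\<close> makes the last two summands
      \<open>Q\<^sup>2 - (q - c * \<mu>1)\<^sup>2\<close>, and \<open>Q2\<close> supplies the
      remaining \<open>(b - 1) * Q\<^sup>2\<close>.\<close>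
    have "b * M = b * (a * \<mu>1\<^sup>2 + q\<^sup>2 - 2 * q * \<mu>1) + (b * t)\<^sup>2 + 2 * (b * t) * (c * \<mu>1 - q)"
      unfolding M_def st[symmetric] by algebra
    also have "\<dots> = b * Q\<^sup>2"
      unfolding bt using Q2 by algebra
    finally have "sqrt M = Q"
      using assms(5) Q0 by simp
    hence "expected_payoff q P \<le> (Q + \<mu>1 - q + s * \<mu>2) / 2 + (1 - s) * \<mu>2"
      using expected_payoff_le[OF P[unfolded theta_def] s, of q] by (simp add: M_def)
    also have "\<dots> = (Q + \<mu>1 - q - t) / 2 + \<mu>2"
      unfolding st[symmetric] by (simp add: field_simps)
    also have "\<dots> = V"
      unfolding V t_def using assms(5) by (simp add: field_simps)
    finally show ?thesis .
  qed
  have v: "v_P q (theta \<mu>1 \<mu>2 a b c) = ereal V"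
    unfolding v_P_def
  proof (rule antisym)
    show "(SUP P\<in>feasible (theta \<mu>1 \<mu>2 a b c). ereal (expected_payoff q P)) \<le> ereal V"
      by (intro SUP_least) (simp add: bound)
    show "ereal V \<le> (SUP P\<in>feasible (theta \<mu>1 \<mu>2 a b c). ereal (expected_payoff q P))"
      using SUP_upper[OF feas, of "\<lambda>P. ereal (expected_payoff q P)"] by (simp add: payoff)
  qed
  show ?thesis
    using wf feas payoff v by (simp add: optimal_def V_def Q_def)
qed

end
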